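(* Let $\{\epsilon_l\}_{l\in\mathbb N}$ be a sequence of positive reals and $\{M_l\},\{k_l\},\{n_l\}$ sequences in $\mathbb N$ with $k_l\to\infty$ as $l\to\infty$. For each $l$ let $\mathcal P_l\subset P_{k_l(n_l+M_l)}$ be an $\epsilon_l$-independent set (with parameters $k_l,n_l,M_l$), let $\nu_l^w$ be the associated weighted probability measure on $P_{k_l(n_l+M_l)}$ (defined in the context), and let $h_l:P\to\mathbb R$ be a function. Put $a_i=(i-1)(n_l+M_l)$ and $s_l^2=\sum_{i=1}^{k_l}\sigma^2_{\mathcal P_l}(S_{a_i}^{n_l}h_l)$. Assume $$\lim_{l\to\infty}\frac1{s_l^j}\sum_{i=1}^{k_l}\int\left(\omega_{a_i}^{n_l}(h_l,4\epsilon_l,p)\right)^jd\nu_{\mathcal P_l}(p)=0,\qquad j=1,2,$$ and $$\lim_{l\to\infty}\frac{k_l^2M_l^2\|h_l\|_\infty^2}{s_l^2}=0.$$ If the Lindeberg condition $$\lim_{l\to\infty}\frac1{s_l^2}\sum_{i=1}^{k_l}L_{\mathcal P_l}(S_{a_i}^{n_l}h_l,\eta s_l)=0\qquad\text{for all }\eta>0$$ holds, then the CLT holds with respect to $\nu_l^w$: for every $t\in\mathbb R$, $$\lim_{l\to\infty}\nu_l^w\left(\Big\{S^{k_l(n_l+M_l)}h_l-\mathbb E_{\nu_l^w}\big(S^{k_l(n_l+M_l)}h_l\big)\leqslant ts_l\Big\}\right)=\mathcal N(t).$$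
   Context: $(X,d)$ is a compact metric space and $T:X\to X$ is continuous. $P_n=\{x\in X:T^nx=x\}$, $P=\bigcup_nP_n$; each $P_n$ is finite. $d_n(x,y)=\sup_{0\leqslant k\leqslant n-1}d(T^kx,T^ky)$, $B^n_\epsilon(x)=\{y\in X:d_n(x,y)<\epsilon\}$. $E$ $(n,\epsilon)$-spans $Y$ if $Y\subset\bigcup_{x\in E}B^n_\epsilon(x)$. $\epsilon$-independence: for $\epsilon>0$ and $k,n,M\in\mathbb N$, a set $\mathcal P\subset P_{k(n+M)}$ is $\epsilon$-independent if there exist $E\subset P_{n+M}$ which $(n,3\epsilon)$-spans $P_{k(n+M)}$ and a bijection $\Phi:E^k\to\mathcal P$ such that $T^{(i-1)(n+M)}(\Phi(\mathbf x))\in B^n_\epsilon(x_i)$ for all $\mathbf x=(x_1,\dots,x_k)\in E^k$, $1\leqslant i\leqslant k$. Weighted measure: given an $\epsilon$-independent set $\mathcal P\subset P_{k(n+M)}$ with its $E$ and $\Phi$, for $p\in\mathcal P$ with $(x_1,\dots,x_k)=\Phi^{-1}(p)$ let $Q(p)=\{q\in P_{k(n+M)}:d_n(T^{(i-1)(n+M)}q,x_i)<3\epsilon\ \forall\,1\leqslant i\leqslant k\}$. Define $\nu^w(A)=\sum_{q\in P_{k(n+M)}}w(q)\mathbb 1_A(q)$ with $w(q)=\frac1{|\mathcal P|}\sum_{\{p\in\mathcal P:\,q\in Q(p)\}}\frac1{|Q(p)|}$. The measure $\nu_l^w$ is $\nu^w$ for $\mathcal P=\mathcal P_l$, $\epsilon=\epsilon_l$,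 $k=k_l$, $n=n_l$, $M=M_l$. For a finite set $Z\subset X$, $\nu_Z$ is the uniform probability on $Z$, and $\mathbb E_Z$, $\sigma_Z^2$ are expectation and variance with respect to $\nu_Z$; $L_Z(h,\eta)=\int(h-\mathbb E_Z(h))^2\,\mathbb 1_{\{|h-\mathbb E_Z(h)|>\eta\}}\,d\nu_Z$. $S_m^nh(x)=\sum_{i=m}^{m+n-1}h(T^ix)$, $S^nh=S_0^nh$. For $h:P\to\mathbb R$, $\omega_m^n(h,\epsilon,x)=\sup\{|S_m^nh(x)-S^nh(y)|:y\in B^n_\epsilon(T^mx)\cap P\}$. $\mathcal N(t)=\frac1{\sqrt{2\pi}}\int_{-\infty}^te^{-u^2/2}du$. It is understood that $s_l>0$. *)

theory Defs
  imports "HOL-Probability.Probability"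
begin

definition per :: "'a set \<Rightarrow> ('a \<Rightarrow> 'a) \<Rightarrow> nat \<Rightarrow> 'a set" where
  "per X T n = {x \<in> X. (T ^^ n) x = x}"

text \<open>The union runs over positive periods only, since every point is fixed by the zeroth iterate.\<close>

definition per_all :: "'a set \<Rightarrow> ('a \<Rightarrow> 'a) \<Rightarrow> 'a set" where
  "per_all X T = (\<Union>n\<in>{0<..}. per X T n)"

definition bowen_dist :: "('a::metric_space \<Rightarrow> 'a) \<Rightarrow> nat \<Rightarrow> 'a \<Rightarrow> 'a \<Rightarrow> real" where
  "bowen_dist T n x y = (SUP i\<in>{..<n}. dist ((T ^^ i) x) ((T ^^ i) y))"

definition bowen_ball ::
  "'a::metric_space set \<Rightarrow> ('a \<Rightarrow> 'a) \<Rightarrow> nat \<Rightarrow> real \<Rightarrow> 'a \<Rightarrow> 'a set" where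
  "bowen_ball X T n \<epsilon> x = {y \<in> X. bowen_dist T n x y < \<epsilon>}"

definition spans ::
  "'a::metric_space set \<Rightarrow> ('a \<Rightarrow> 'a) \<Rightarrow> nat \<Rightarrow> real \<Rightarrow> 'a set \<Rightarrow> 'a set \<Rightarrow> bool" where
  "spans X T n \<epsilon> E Y \<longleftrightarrow> Y \<subseteq> (\<Union>x\<in>E. bowen_ball X T n \<epsilon> x)"

definition block_start :: "nat \<Rightarrow> nat \<Rightarrow> nat \<Rightarrow> nat" where
  "block_start n M i = (i - 1) * (n + M)"

text \<open>
  Elements of the power \<open>E\<^sup>k\<close> are functions on \<open>{1..k}\<close> with values in \<open>E\<close>,
  extended by \<open>undefined\<close>.
\<close>

abbreviation tuples :: "nat \<Rightarrow> 'a set \<Rightarrow> (nat \<Rightarrow> 'a) set" where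
  "tuples k E \<equiv> PiE {1..k} (\<lambda>_. E)"

text \<open>
  \<open>indep_via X T \<epsilon> k n M \<P> E \<Phi>\<close> says that \<open>\<P>\<close> is \<open>\<epsilon>\<close>-independent and that \<open>E\<close> and \<open>\<Phi>\<close> are
  a spanning set and a bijection witnessing this; the weighted measure depends on both.
\<close>

definition indep_via ::
  "'a::metric_space set \<Rightarrow> ('a \<Rightarrow> 'a) \<Rightarrow> real \<Rightarrow> nat \<Rightarrow> nat \<Rightarrow> nat \<Rightarrow>
   'a set \<Rightarrow> 'a set \<Rightarrow> ((nat \<Rightarrow> 'a) \<Rightarrow> 'a) \<Rightarrow> bool" where
  "indep_via X T \<epsilon> k n M \<P> E \<Phi> \<longleftrightarrow>
     \<P> \<subseteq> per X T (k * (n + M)) \<and>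
     E \<subseteq> per X T (n + M) \<and>
     spans X T n (3 * \<epsilon>) E (per X T (k * (n + M))) \<and>
     bij_betw \<Phi> (tuples k E) \<P> \<and>
     (\<forall>x\<in>tuples k E. \<forall>i\<in>{1..k}.
        (T ^^ block_start n M i) (\<Phi> x) \<in> bowen_ball X T n \<epsilon> (x i))"

definition shadow_set ::
  "'a::metric_space set \<Rightarrow> ('a \<Rightarrow> 'a) \<Rightarrow> real \<Rightarrow> nat \<Rightarrow> nat \<Rightarrow> nat \<Rightarrow>
   'a set \<Rightarrow> ((nat \<Rightarrow> 'a) \<Rightarrow> 'a) \<Rightarrow> 'a \<Rightarrow> 'a set" where
  "shadow_set X T \<epsilon> k n M E \<Phi> p =
     {q \<in> per X T (k * (n + M)). \<forall>i\<in>{1..k}.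
        bowen_dist T n ((T ^^ block_start n M i) q) (inv_into (tuples k E) \<Phi> p i) < 3 * \<epsilon>}"

definition weight ::
  "'a::metric_space set \<Rightarrow> ('a \<Rightarrow> 'a) \<Rightarrow> real \<Rightarrow> nat \<Rightarrow> nat \<Rightarrow> nat \<Rightarrow>
   'a set \<Rightarrow> 'a set \<Rightarrow> ((nat \<Rightarrow> 'a) \<Rightarrow> 'a) \<Rightarrow> 'a \<Rightarrow> real" where
  "weight X T \<epsilon> k n M \<P> E \<Phi> q =
     1 / real (card \<P>) *
     (\<Sum>p\<in>{p \<in> \<P>. q \<in> shadow_set X T \<epsilon> k n M E \<Phi> p}.
        1 / real (card (shadow_set X T \<epsilon> k n M E \<Phi> p)))"

text \<open>A measure whose space is the finite set of periodic points of period \<open>k * (n + M)\<close>.\<close>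

definition weighted_measure ::
  "'a::metric_space set \<Rightarrow> ('a \<Rightarrow> 'a) \<Rightarrow> real \<Rightarrow> nat \<Rightarrow> nat \<Rightarrow> nat \<Rightarrow>
   'a set \<Rightarrow> 'a set \<Rightarrow> ((nat \<Rightarrow> 'a) \<Rightarrow> 'a) \<Rightarrow> 'a measure" where
  "weighted_measure X T \<epsilon> k n M \<P> E \<Phi> =
     point_measure (per X T (k * (n + M))) (\<lambda>q. ennreal (weight X T \<epsilon> k n M \<P> E \<Phi> q))"

definition unif_mean :: "'a set \<Rightarrow> ('a \<Rightarrow> real) \<Rightarrow> real" where
  "unif_mean Z h = (\<integral>x. h x \<partial>uniform_count_measure Z)"

definition unif_variance :: "'a set \<Rightarrow> ('a \<Rightarrow> real) \<Rightarrow> real" where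
  "unif_variance Z h = (\<integral>x. (h x - unif_mean Z h)\<^sup>2 \<partial>uniform_count_measure Z)"

definition lindeberg :: "'a set \<Rightarrow> ('a \<Rightarrow> real) \<Rightarrow> real \<Rightarrow> real" where
  "lindeberg Z h \<eta> =
     (\<integral>x. (h x - unif_mean Z h)\<^sup>2 * indicator {x. \<bar>h x - unif_mean Z h\<bar> > \<eta>} x
        \<partial>uniform_count_measure Z)"

definition birkhoff ::
  "('a \<Rightarrow> 'a) \<Rightarrow> nat \<Rightarrow> nat \<Rightarrow> ('a \<Rightarrow> real) \<Rightarrow> 'a \<Rightarrow> real" where
  "birkhoff T m n h x = (\<Sum>i\<in>{m..<m + n}. h ((T ^^ i) x))"

text \<open>
  A function on the periodic points is represented by a total function whose values elsewhere are
  irrelevant.  It may be unbounded, so the two suprema below are taken in \<open>ennreal\<close>.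
\<close>

definition oscillation ::
  "'a::metric_space set \<Rightarrow> ('a \<Rightarrow> 'a) \<Rightarrow> nat \<Rightarrow> nat \<Rightarrow> ('a \<Rightarrow> real) \<Rightarrow> real \<Rightarrow> 'a \<Rightarrow> ennreal" where
  "oscillation X T m n h \<epsilon> x =
     (SUP y\<in>bowen_ball X T n \<epsilon> ((T ^^ m) x) \<inter> per_all X T.
        ennreal \<bar>birkhoff T m n h x - birkhoff T 0 n h y\<bar>)"

definition sup_norm :: "'a set \<Rightarrow> ('a \<Rightarrow> 'a) \<Rightarrow> ('a \<Rightarrow> real) \<Rightarrow> ennreal" where
  "sup_norm X T h = (SUP x\<in>per_all X T. ennreal \<bar>h x\<bar>)"

end

theory Submission
  imports Defs
begin

text \<open>
  Choose $p$ uniformly in \<open>\<P>\<close> and then $q$ uniformly in its shadow set \<open>Q p\<close>. The law of $q$ is exactly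
  the weighted measure, so this is a coupling of the weighted measure with the uniform measure on
  \<open>\<P>\<close> (\<open>integral_\<nu>\<close>). Write $x = \Phi^{-1}(p)$. In each block $i$ the orbit segments of
  $T^{a_i} p$, of $T^{a_i} q$ and of $x_i$ are within $4\epsilon$ of one another, so that
  $S_{a_i}^n h(q)$ and $S^n h(x_i)$ differ from the block sum $S_{a_i}^n h(p)$ by at most
  $\omega_{a_i}^n(h, 4\epsilon, p)$. Since $\Phi$ is a bijection from $E^k$, the
  variables $S^n h(x_i)$ are independent, each distributed as $S^n h$ under the uniform measure on $E$;
  the block sums of $p$ itself need not be independent, because $T^{a_i} \Phi(x)$ depends on all of $x$.

  The hypotheses are used as follows. The oscillation condition with $j = 2$ transfers the variance
  normalisation and the Lindeberg condition from the block sums of $p$ to the independent variables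
  (\<open>variance_comparison\<close>, \<open>lindeberg_comparison\<close>). These form a triangular array whose
  rows are independent and identically distributed, for which the Lindeberg theorem gives convergence of the
  characteristic functions to the Gaussian one (\<open>row_iid_lindeberg\<close>). The oscillation condition
  with $j = 1$, together with the bound on the gaps of length $M$ between consecutive blocks, shows that the full
  Birkhoff sum at $q$ and the sum of the independent variables differ by $o(s)$ in mean under the
  coupling (\<open>birkhoff_coupling\<close>). The same then holds for their expectations, and since
  $u \mapsto e^{iu}$ is 1-Lipschitz, the two centred and normalised sums have characteristic functions
  with the same limit (\<open>char_comparison\<close>). Levy's continuity theorem concludes.
\<close>

section \<open>Averages over finite sets\<close>

text \<open>
  Expectations of both real and complex functions occur below, so averages take values in any real
  vector space. The average over the empty set is zero, as is the corresponding integral.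
\<close>

definition average :: "'a set \<Rightarrow> ('a \<Rightarrow> 'b::real_vector) \<Rightarrow> 'b" where
  "average Z f = (\<Sum>z\<in>Z. f z) /\<^sub>R real (card Z)"

lemma average_cong: "(\<And>z. z \<in> Z \<Longrightarrow> f z = g z) \<Longrightarrow> average Z f = average Z g"
  by (simp add: average_def)

lemma average_add: "average Z (\<lambda>z. f z + g z) = average Z f + average Z g"
  by (simp add: average_def sum.distrib scaleR_right_distrib)

lemma average_diff: "average Z (\<lambda>z. f z - g z) = average Z f - average Z g"
  by (simp add: average_def sum_subtractf scaleR_right_diff_distrib)

lemma average_scale: "average Z (\<lambda>z. c * f z) = c * average Z (f :: _ \<Rightarrow> real)"
  by (simp add: average_def sum_distrib_left[symmetric])

lemma average_divide: "average Z (\<lambda>z. f z / c) = average Z (f :: _ \<Rightarrow> real) / c"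
  by (simp add: average_def sum_divide_distrib[symmetric])

lemma average_sum: "average Z (\<lambda>z. \<Sum>i\<in>I. f i z) = (\<Sum>i\<in>I. average Z (f i))"
  by (simp add: average_def sum.swap[of _ Z] scaleR_sum_right)

lemma average_const: "finite Z \<Longrightarrow> Z \<noteq> {} \<Longrightarrow> average Z (\<lambda>_. c) = c"
  by (simp add: average_def sum_constant_scaleR)

lemma average_mono:
  fixes f g :: "'a \<Rightarrow> real"
  shows "(\<And>z. z \<in> Z \<Longrightarrow> f z \<le> g z) \<Longrightarrow> average Z f \<le> average Z g"
  by (simp add: average_def sum_mono mult_left_mono)

lemma average_nonneg:
  fixes f :: "'a \<Rightarrow> real"
  shows "(\<And>z. z \<in> Z \<Longrightarrow> 0 \<le> f z) \<Longrightarrow> 0 \<le> average Z f"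
  by (simp add: average_def sum_nonneg)

lemma norm_average_le:
  fixes f :: "'a \<Rightarrow> 'b::real_normed_vector"
  shows "norm (average Z f) \<le> average Z (\<lambda>z. norm (f z))"
  by (simp add: average_def norm_sum mult_left_mono)

lemma average_reindex: "bij_betw \<phi> A B \<Longrightarrow> average A (\<lambda>x. f (\<phi> x)) = average B f"
  by (simp add: average_def sum.reindex_bij_betw bij_betw_same_card)

lemma integral_uniform_count_measure_eq_average:
  fixes f :: "'a \<Rightarrow> 'b::{banach, second_countable_topology}"
  assumes "finite Z"
  shows "integral\<^sup>L (uniform_count_measure Z) f = average Z f"
  using assms
  by (simp add: uniform_count_measure_def lebesgue_integral_point_measure_finite average_def
      scaleR_sum_right inverse_eq_divide)

lemma unif_mean_eq_average: "finite Z \<Longrightarrow> unif_mean Z h = average Z h"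
  by (simp add: unif_mean_def integral_uniform_count_measure_eq_average)

lemma unif_variance_eq_average:
  "finite Z \<Longrightarrow> unif_variance Z h = average Z (\<lambda>z. (h z - average Z h)\<^sup>2)"
  by (simp add: unif_variance_def integral_uniform_count_measure_eq_average unif_mean_eq_average)

lemma lindeberg_eq_average:
  "finite Z \<Longrightarrow> lindeberg Z h \<eta> =
    average Z (\<lambda>z. if \<bar>h z - average Z h\<bar> > \<eta> then (h z - average Z h)\<^sup>2 else 0)"
  by (simp add: lindeberg_def integral_uniform_count_measure_eq_average unif_mean_eq_average
      indicator_def of_bool_def if_distrib[of "(*) _"] cong: if_cong)

section \<open>Stability of variance and truncated second moments in $L^2$\<close>

lemma average_centred_square_le:
  fixes f :: "'a \<Rightarrow> real"
  assumes "finite Z" "Z \<noteq> {}"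
  shows "average Z (\<lambda>z. (f z - average Z f)\<^sup>2) \<le> average Z (\<lambda>z. (f z)\<^sup>2)"
proof -
  have "average Z (\<lambda>z. (f z - average Z f)\<^sup>2)
      = average Z (\<lambda>z. (f z)\<^sup>2 - 2 * average Z f * f z + (average Z f)\<^sup>2)"
    by (intro average_cong) (simp add: power2_eq_square algebra_simps)
  also have "\<dots> = average Z (\<lambda>z. (f z)\<^sup>2) - (average Z f)\<^sup>2"
    using assms
    by (simp add: average_add average_diff average_scale average_const power2_eq_square)
  finally show ?thesis by simp
qed

text \<open>
  Centring does not increase the second moment of $f - g$, so it suffices to compare the squares of the
  centred functions $u$ and $v$ pointwise: $u^2 - v^2 = 2vc + c^2$ with $c = u - v$, and
  $2|vc| \le \theta v^2 + c^2/\theta$.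
\<close>

lemma unif_variance_perturb:
  fixes \<theta> :: real
  assumes Z: "finite Z" "Z \<noteq> {}" and \<theta>: "0 < \<theta>"
  shows "\<bar>unif_variance Z f - unif_variance Z g\<bar>
    \<le> \<theta> * unif_variance Z g + (1 + 1 / \<theta>) * average Z (\<lambda>z. (f z - g z)\<^sup>2)"
proof -
  define u where "u z = f z - average Z f" for z
  define v where "v z = g z - average Z g" for z
  have uv: "average Z (\<lambda>z. (u z - v z)\<^sup>2) \<le> average Z (\<lambda>z. (f z - g z)\<^sup>2)"
    using average_centred_square_le[OF Z, of "\<lambda>z. f z - g z"]
    by (simp add: u_def v_def average_diff algebra_simps)
  have pt: "\<bar>(u z)\<^sup>2 - (v z)\<^sup>2\<bar> \<le> \<theta> * (v z)\<^sup>2 + (1 + 1 / \<theta>) * (u z - v z)\<^sup>2" for z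
  proof -
    define c where "c = u z - v z"
    have "0 \<le> (\<theta> * v z - c)\<^sup>2 / \<theta>" "0 \<le> (\<theta> * v z + c)\<^sup>2 / \<theta>" using \<theta> by simp_all
    then have "2 * v z * c \<le> \<theta> * (v z)\<^sup>2 + c\<^sup>2 / \<theta>" "- (2 * v z * c) \<le> \<theta> * (v z)\<^sup>2 + c\<^sup>2 / \<theta>"
      using \<theta> by (simp_all add: power2_eq_square field_simps)
    moreover have "(u z)\<^sup>2 - (v z)\<^sup>2 = 2 * v z * c + c\<^sup>2"
      by (simp add: c_def power2_eq_square algebra_simps)
    moreover have "0 \<le> c\<^sup>2" "0 \<le> c\<^sup>2 / \<theta>" using \<theta> by simp_all
    ultimately have "\<bar>(u z)\<^sup>2 - (v z)\<^sup>2\<bar> \<le> \<theta> * (v z)\<^sup>2 + (c\<^sup>2 + c\<^sup>2 / \<theta>)" by linarith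
    then show ?thesis by (simp add: c_def[symmetric] algebra_simps)
  qed
  have "\<bar>unif_variance Z f - unif_variance Z g\<bar> = norm (average Z (\<lambda>z. (u z)\<^sup>2 - (v z)\<^sup>2))"
    using Z by (simp add: unif_variance_eq_average u_def v_def average_diff)
  also have "\<dots> \<le> average Z (\<lambda>z. \<bar>(u z)\<^sup>2 - (v z)\<^sup>2\<bar>)"
    using norm_average_le[of Z "\<lambda>z. (u z)\<^sup>2 - (v z)\<^sup>2"] by simp
  also have "\<dots> \<le> average Z (\<lambda>z. \<theta> * (v z)\<^sup>2 + (1 + 1 / \<theta>) * (u z - v z)\<^sup>2)"
    by (intro average_mono pt)
  also have "\<dots> = \<theta> * unif_variance Z g + (1 + 1 / \<theta>) * average Z (\<lambda>z. (u z - v z)\<^sup>2)"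
    using Z by (simp add: average_add average_scale unif_variance_eq_average v_def)
  also have "\<dots> \<le> \<theta> * unif_variance Z g + (1 + 1 / \<theta>) * average Z (\<lambda>z. (f z - g z)\<^sup>2)"
    using uv \<theta> by (intro add_left_mono mult_left_mono) auto
  finally show ?thesis .
qed

text \<open>
  Let $u$ and $v$ be the centred functions and suppose $|u| > \eta$. Either $|u - v| \le |v|$, and then
  $|u| \le 2|v|$, so that $v$ exceeds $\eta/2$ and $u^2 \le 4v^2$; or $|u| \le 2|u - v|$, and
  then $u^2$ is absorbed by the second term.
\<close>

lemma lindeberg_perturb:
  assumes Z: "finite Z" "Z \<noteq> {}" and \<eta>: "0 < \<eta>"
  shows "lindeberg Z f \<eta> \<le> 4 * lindeberg Z g (\<eta> / 2) + 4 * average Z (\<lambda>z. (f z - g z)\<^sup>2)"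
proof -
  define u where "u z = f z - average Z f" for z
  define v where "v z = g z - average Z g" for z
  have uv: "average Z (\<lambda>z. (u z - v z)\<^sup>2) \<le> average Z (\<lambda>z. (f z - g z)\<^sup>2)"
    using average_centred_square_le[OF Z, of "\<lambda>z. f z - g z"]
    by (simp add: u_def v_def average_diff algebra_simps)
  have pt: "(if \<bar>u z\<bar> > \<eta> then (u z)\<^sup>2 else 0)
      \<le> 4 * (if \<bar>v z\<bar> > \<eta> / 2 then (v z)\<^sup>2 else 0) + 4 * (u z - v z)\<^sup>2" for z
  proof (cases "\<bar>u z\<bar> > \<eta>")
    case True
    show ?thesis
    proof (cases "\<bar>u z - v z\<bar> \<le> \<bar>v z\<bar>")
      case small: True
      then have "\<bar>u z\<bar> \<le> \<bar>2 * v z\<bar>" by linarith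
      then have "(u z)\<^sup>2 \<le> 4 * (v z)\<^sup>2"
        by (simp only: abs_le_square_iff power_mult_distrib) simp
      moreover have "\<bar>v z\<bar> > \<eta> / 2" using small True by linarith
      ultimately show ?thesis using True by (simp add: add_increasing2)
    next
      case False
      then have "\<bar>u z\<bar> \<le> 2 * \<bar>u z - v z\<bar>"
        using abs_triangle_ineq[of "u z - v z" "v z"] by simp
      then have "\<bar>u z\<bar> \<le> \<bar>2 * (u z - v z)\<bar>" by (simp only: abs_mult abs_numeral)
      then have "(u z)\<^sup>2 \<le> 4 * (u z - v z)\<^sup>2" 
        by (simp only: abs_le_square_iff power_mult_distrib) simp
      then show ?thesis by (simp add: add_increasing)
    qed
  qed simp
  have "lindeberg Z f \<eta> \<le> average Z (\<lambda>z. 4 * (if \<bar>v z\<bar> > \<eta> / 2 then (v z)\<^sup>2 else 0) + 4 * (u z - v z)\<^sup>2)"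
    unfolding lindeberg_eq_average[OF Z(1)] u_def[symmetric] by (intro average_mono pt)
  also have "\<dots> = 4 * lindeberg Z g (\<eta> / 2) + 4 * average Z (\<lambda>z. (u z - v z)\<^sup>2)"
    unfolding lindeberg_eq_average[OF Z(1)] v_def by (simp only: average_add average_scale)
  finally show ?thesis using uv by linarith
qed

section \<open>The Lindeberg theorem for arrays with identically distributed rows\<close>

lemma cmod_iexp_diff_le: "cmod (iexp x - iexp y) \<le> \<bar>x - y\<bar>"
proof -
  have "iexp x - iexp y = iexp y * (iexp (x - y) - 1)"
    by (simp add: algebra_simps flip: exp_add)
  then have "cmod (iexp x - iexp y) = cmod (iexp (x - y) - 1)"
    by (simp add: norm_mult)
  also have "\<dots> \<le> \<bar>x - y\<bar>"
    using iexp_approx1[of "x - y" 0] by simp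
  finally show ?thesis .
qed

text \<open>
  The second-order Taylor remainder of $e^{itx}$ is at most $\frac{t^2}{6} \min(6x^2, |t||x|^3)$;
  the quadratic bound serves where $|x| > \eta$ and the cubic one elsewhere.
\<close>

lemma average_iexp_approx:
  fixes f :: "'a \<Rightarrow> real"
  assumes E: "finite E" "E \<noteq> {}" and mean: "average E f = 0" and \<eta>: "0 < \<eta>"
  shows "cmod (average E (\<lambda>e. iexp (t * f e)) - (1 - t\<^sup>2 * average E (\<lambda>e. (f e)\<^sup>2) / 2))
    \<le> t\<^sup>2 / 6 * (6 * average E (\<lambda>e. if \<bar>f e\<bar> > \<eta> then (f e)\<^sup>2 else 0)
        + \<bar>t\<bar> * \<eta> * average E (\<lambda>e. (f e)\<^sup>2))"
proof -
  interpret prob_space "uniform_count_measure E"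
    using E by (rule prob_space_uniform_count_measure)
  have [simp]: "integrable (uniform_count_measure E) g" for g :: "'a \<Rightarrow> real"
    using E by (simp add: uniform_count_measure_def integrable_point_measure_finite)
  have [measurable]: "g \<in> borel_measurable (uniform_count_measure E)" for g :: "'a \<Rightarrow> real"
    by (simp add: borel_measurable_integrable)
  have "cmod (char (distr (uniform_count_measure E) borel f) t - (1 - t\<^sup>2 * average E (\<lambda>e. (f e)\<^sup>2) / 2))
    \<le> t\<^sup>2 / 6 * expectation (\<lambda>x. min (6 * (f x)\<^sup>2) (\<bar>t\<bar> * \<bar>f x\<bar> ^ 3))"
    by (rule char_approx3') (use E mean in \<open>auto simp: integral_uniform_count_measure_eq_average\<close>)
  moreover have "char (distr (uniform_count_measure E) borel f) t = average E (\<lambda>e. iexp (t * f e))"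
    using E by (simp add: char_def integral_distr integral_uniform_count_measure_eq_average)
  moreover have "expectation (\<lambda>x. min (6 * (f x)\<^sup>2) (\<bar>t\<bar> * \<bar>f x\<bar> ^ 3))
      \<le> 6 * average E (\<lambda>e. if \<bar>f e\<bar> > \<eta> then (f e)\<^sup>2 else 0) + \<bar>t\<bar> * \<eta> * average E (\<lambda>e. (f e)\<^sup>2)"
  proof -
    have pt: "min (6 * (f e)\<^sup>2) (\<bar>t\<bar> * \<bar>f e\<bar> ^ 3)
        \<le> 6 * (if \<bar>f e\<bar> > \<eta> then (f e)\<^sup>2 else 0) + (\<bar>t\<bar> * \<eta>) * (f e)\<^sup>2" for e
    proof (cases "\<bar>f e\<bar> > \<eta>")
      case True
      then show ?thesis using \<eta> by (simp add: min.coboundedI1)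
    next
      case False
      have "\<bar>f e\<bar> ^ 3 = \<bar>f e\<bar> * (f e)\<^sup>2"
        by (simp add: power3_eq_cube power2_eq_square)
      also have "\<dots> \<le> \<eta> * (f e)\<^sup>2" using False by (intro mult_right_mono) auto
      finally have "\<bar>t\<bar> * \<bar>f e\<bar> ^ 3 \<le> \<bar>t\<bar> * (\<eta> * (f e)\<^sup>2)" by (intro mult_left_mono) auto
      then show ?thesis using False by (simp add: min.coboundedI2 mult.assoc)
    qed
    have "average E (\<lambda>e. min (6 * (f e)\<^sup>2) (\<bar>t\<bar> * \<bar>f e\<bar> ^ 3))
      \<le> average E (\<lambda>e. 6 * (if \<bar>f e\<bar> > \<eta> then (f e)\<^sup>2 else 0) + (\<bar>t\<bar> * \<eta>) * (f e)\<^sup>2)"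
      by (intro average_mono pt)
    then show ?thesis 
      using E by (simp only: average_add average_scale integral_uniform_count_measure_eq_average)
  qed
  ultimately show ?thesis
    by (smt (verit) mult_left_mono zero_le_divide_iff zero_le_power2)
qed

text \<open>
  The coordinates of a uniformly random tuple are independent; expanding the $k$-th power on the right
  into a sum over tuples is the finite form of this fact for characteristic functions.
\<close>

lemma average_iexp_sum_tuples:
  fixes f :: "'a \<Rightarrow> real"
  assumes "finite E"
  shows "average (tuples k E) (\<lambda>x. iexp (t * (\<Sum>i=1..k. f (x i))))
    = average E (\<lambda>e. iexp (t * f e)) ^ k"
proof -
  have "iexp (t * (\<Sum>i=1..k. f (x i))) = (\<Prod>i\<in>{1..k}. iexp (t * f (x i)))" for x :: "nat \<Rightarrow> 'a"
    by (simp add: sum_distrib_left exp_sum)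
  then have "(\<Sum>x\<in>tuples k E. iexp (t * (\<Sum>i=1..k. f (x i))))
      = (\<Sum>x\<in>tuples k E. \<Prod>i\<in>{1..k}. iexp (t * f (x i)))"
    by (simp only:)
  also have "\<dots> = (\<Prod>i\<in>{1..k}. \<Sum>e\<in>E. iexp (t * f e))"
    using assms by (intro prod_sum_PiE[symmetric]) auto
  also have "\<dots> = (\<Sum>e\<in>E. iexp (t * f e)) ^ k" by simp
  finally have "(\<Sum>x\<in>tuples k E. iexp (t * (\<Sum>i=1..k. f (x i)))) = (\<Sum>e\<in>E. iexp (t * f e)) ^ k" .
  then show ?thesis
    by (simp add: average_def card_PiE scaleR_power power_inverse)
qed

lemma average_tuples_coordinate:
  fixes f :: "'a \<Rightarrow> real"
  assumes E: "finite E" "E \<noteq> {}" and i: "i \<in> {1..k}"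
  shows "average (tuples k E) (\<lambda>x. f (x i)) = average E f"
proof -
  \<comment> \<open>The function of one coordinate is written as a product over all of them, to exchange product and sum.\<close>
  have "(\<Sum>x\<in>tuples k E. f (x i)) = (\<Sum>x\<in>tuples k E. \<Prod>j\<in>{1..k}. if j = i then f (x j) else 1)"
    using i by (intro sum.cong refl) (simp add: prod.delta)
  also have "\<dots> = (\<Prod>j\<in>{1..k}. \<Sum>e\<in>E. if j = i then f e else 1)"
    using E by (intro prod_sum_PiE[symmetric]) auto
  also have "\<dots> = (\<Prod>j\<in>{1..k}. real (card E) * (if j = i then average E f else 1))"
    using E by (intro prod.cong) (auto simp: average_def)
  also have "\<dots> = real (card E) ^ k * average E f"
    using i by (simp add: prod.distrib prod.delta)
  finally show ?thesis
    unfolding average_def[of "tuples k E"] using E by (simp add: card_PiE)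
qed

text \<open>
  By \<open>average_iexp_approx\<close> the characteristic function of one summand is $1 - t^2 v / 2$, up to an error that
  after multiplication by $k$ is at most a constant multiple of $k L(\eta) + \eta k v$; and since
  $kv \to 1$, replacing $v$ by $1/k$ costs only $o(1/k)$. As $z \mapsto z^k$ is
  $k$-Lipschitz on the unit disc, the $k$-th power has the same limit as $(1 - t^2/(2k))^k$.
\<close>

lemma row_iid_lindeberg:
  fixes E :: "nat \<Rightarrow> 'a set" and f :: "nat \<Rightarrow> 'a \<Rightarrow> real" and k :: "nat \<Rightarrow> nat"
  assumes E: "\<And>l. finite (E l)" "\<And>l. E l \<noteq> {}" and mean: "\<And>l. average (E l) (f l) = 0"
    and k_lim: "filterlim k at_top sequentially" and k_pos: "\<And>l. 0 < k l"
    and var: "(\<lambda>l. real (k l) * average (E l) (\<lambda>e. (f l e)\<^sup>2)) \<longlonglongrightarrow> 1"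
    and lind: "\<And>\<eta>. 0 < \<eta> \<Longrightarrow>
      (\<lambda>l. real (k l) * average (E l) (\<lambda>e. if \<bar>f l e\<bar> > \<eta> then (f l e)\<^sup>2 else 0)) \<longlonglongrightarrow> 0"
  shows "(\<lambda>l. average (E l) (\<lambda>e. iexp (t * f l e)) ^ k l) \<longlonglongrightarrow> char std_normal_distribution t"
proof -
  define \<phi> where "\<phi> l = average (E l) (\<lambda>e. iexp (t * f l e))" for l
  define v where "v l = average (E l) (\<lambda>e. (f l e)\<^sup>2)" for l
  define L where "L \<eta> l = average (E l) (\<lambda>e. if \<bar>f l e\<bar> > \<eta> then (f l e)\<^sup>2 else 0)" for \<eta> l
  define c :: "nat \<Rightarrow> real" where "c l = 1 + (- (t\<^sup>2) / 2) / k l" for l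
  have \<phi>_le: "cmod (\<phi> l) \<le> 1" for l
    using norm_average_le[of "E l" "\<lambda>e. iexp (t * f l e)"] E by (simp add: \<phi>_def average_const)
  have k_real: "filterlim (\<lambda>l. real (k l)) at_top sequentially"
    using filterlim_compose[OF filterlim_real_sequentially k_lim] .
  have c_lim: "(\<lambda>l. complex_of_real (c l ^ k l)) \<longlonglongrightarrow> complex_of_real (exp (- (t\<^sup>2) / 2))"
    unfolding c_def
    by (intro tendsto_of_real filterlim_compose[OF tendsto_exp_limit_sequentially k_lim])
  \<comment> \<open>This bound is what puts the comparison value in the unit disc, where the Lipschitz estimate applies.\<close>
  have c_le: "\<forall>\<^sub>F l in sequentially. cmod (complex_of_real (c l)) \<le> 1"
  proof -
    have "\<forall>\<^sub>F l in sequentially. t\<^sup>2 / 4 \<le> real (k l)"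
      using k_real unfolding filterlim_at_top by blast
    then show ?thesis
    proof eventually_elim
      case (elim l)
      then have "t\<^sup>2 / 2 / real (k l) \<le> 2" "0 \<le> t\<^sup>2 / 2 / real (k l)" using k_pos[of l] by (simp_all add: field_simps)
      then have "\<bar>c l\<bar> \<le> 1" unfolding c_def by linarith
      then show ?case by simp
    qed
  qed
  have bound: "\<forall>\<^sub>F l in sequentially. cmod (\<phi> l ^ k l - complex_of_real (c l) ^ k l)
      \<le> t\<^sup>2 * (k l * L \<eta> l) + \<bar>t\<bar> ^ 3 / 6 * \<eta> * (k l * v l) + t\<^sup>2 / 2 * \<bar>k l * v l - 1\<bar>"
    if \<eta>: "0 < \<eta>" for \<eta>
    using c_le
  proof eventually_elim
    case (elim l)
    have "cmod (\<phi> l - c l) \<le> cmod (\<phi> l - (1 - t\<^sup>2 * v l / 2)) + cmod (complex_of_real ((1 - t\<^sup>2 * v l / 2) - c l))"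
      using norm_triangle_ineq[of "\<phi> l - (1 - t\<^sup>2 * v l / 2)" "complex_of_real ((1 - t\<^sup>2 * v l / 2) - c l)"]
      by simp
    also have "\<dots> \<le> t\<^sup>2 / 6 * (6 * L \<eta> l + \<bar>t\<bar> * \<eta> * v l) + \<bar>(1 - t\<^sup>2 * v l / 2) - c l\<bar>"
      unfolding norm_of_real
      using average_iexp_approx[OF E mean \<eta>, of l t] by (simp add: \<phi>_def v_def L_def)
    also have "(1 - t\<^sup>2 * v l / 2) - c l = - (t\<^sup>2 / 2 * (k l * v l - 1) / k l)"
      using k_pos[of l] by (simp add: c_def field_simps)
    also have "\<bar>\<dots>\<bar> = t\<^sup>2 / 2 * \<bar>k l * v l - 1\<bar> / k l"
      by (simp add: abs_mult)
    finally have step: "cmod (\<phi> l - c l)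
        \<le> t\<^sup>2 / 6 * (6 * L \<eta> l + \<bar>t\<bar> * \<eta> * v l) + t\<^sup>2 / 2 * \<bar>k l * v l - 1\<bar> / k l" .
    have "cmod (\<phi> l ^ k l - complex_of_real (c l) ^ k l) \<le> k l * cmod (\<phi> l - c l)"
      using \<phi>_le elim by (rule norm_power_diff)
    also have "\<dots> \<le> k l * (t\<^sup>2 / 6 * (6 * L \<eta> l + \<bar>t\<bar> * \<eta> * v l) + t\<^sup>2 / 2 * \<bar>k l * v l - 1\<bar> / k l)"
      using step by (intro mult_left_mono) auto
    also have "\<dots> = t\<^sup>2 * (k l * L \<eta> l) + \<bar>t\<bar> ^ 3 / 6 * \<eta> * (k l * v l) + t\<^sup>2 / 2 * \<bar>k l * v l - 1\<bar>"
      using k_pos[of l] by (simp add: field_simps power3_eq_cube power2_eq_square)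
    finally show ?case .
  qed
  have "(\<lambda>l. \<phi> l ^ k l - complex_of_real (c l) ^ k l) \<longlonglongrightarrow> 0"
  proof (rule tendstoI, unfold dist_norm diff_0_right)
    fix r :: real assume r: "0 < r"
    \<comment> \<open>Only the middle term of the bound survives in the limit; \<open>\<eta>\<close> is chosen to make its limit less than \<open>r\<close>.\<close>
    define b where "b = \<bar>t\<bar> ^ 3 / 6"
    define \<eta> where "\<eta> = r / (b + 1)"
    have b: "0 \<le> b" by (simp add: b_def)
    then have \<eta>: "0 < \<eta>" using r by (simp add: \<eta>_def)
    have "b * \<eta> < (b + 1) * \<eta>" using \<eta> by (simp add: algebra_simps)
    also have "\<dots> = r" using b by (simp add: \<eta>_def)
    finally have small: "\<bar>t\<bar> ^ 3 / 6 * \<eta> < r" by (simp add: b_def)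
    have "(\<lambda>l. t\<^sup>2 * (k l * L \<eta> l) + \<bar>t\<bar> ^ 3 / 6 * \<eta> * (k l * v l) + t\<^sup>2 / 2 * \<bar>k l * v l - 1\<bar>)
      \<longlonglongrightarrow> t\<^sup>2 * 0 + \<bar>t\<bar> ^ 3 / 6 * \<eta> * 1 + t\<^sup>2 / 2 * \<bar>1 - 1\<bar>"
      using var lind[OF \<eta>] unfolding L_def v_def by (intro tendsto_intros)
    then have "\<forall>\<^sub>F l in sequentially.
        t\<^sup>2 * (k l * L \<eta> l) + \<bar>t\<bar> ^ 3 / 6 * \<eta> * (k l * v l) + t\<^sup>2 / 2 * \<bar>k l * v l - 1\<bar> < r"
      by (rule order_tendstoD) (use small in simp)
    with bound[OF \<eta>] show "\<forall>\<^sub>F l in sequentially. cmod (\<phi> l ^ k l - complex_of_real (c l) ^ k l) < r"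
      by eventually_elim simp
  qed
  from tendsto_add[OF this c_lim] show ?thesis
    by (simp add: \<phi>_def char_std_normal_distribution)
qed

section \<open>Orbit segments and Birkhoff sums\<close>

text \<open>
  A supremum of finitely many reals is attained. For \<open>n = 0\<close> the supremum over the empty set is an
  unspecified real.
\<close>

lemma bowen_dist_less_iff:
  assumes "0 < n"
  shows "bowen_dist T n x y < r \<longleftrightarrow> (\<forall>i<n. dist ((T ^^ i) x) ((T ^^ i) y) < r)"
proof -
  have "bowen_dist T n x y = Max ((\<lambda>i. dist ((T ^^ i) x) ((T ^^ i) y)) ` {..<n})"
    unfolding bowen_dist_def using assms by (intro cSup_eq_Max) auto
  then show ?thesis using assms by (subst \<open>bowen_dist T n x y = _\<close>, subst Max_less_iff) auto
qed

lemma funpow_in_invariant: "T ` X \<subseteq> X \<Longrightarrow> x \<in> X \<Longrightarrow> (T ^^ i) x \<in> X"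
  by (induction i) auto

lemma funpow_in_per:
  assumes "T ` X \<subseteq> X" "x \<in> per X T m"
  shows "(T ^^ i) x \<in> per X T m"
proof -
  have "(T ^^ m) ((T ^^ i) x) = (T ^^ i) ((T ^^ m) x)"
    by (metis add.commute comp_apply funpow_add)
  then show ?thesis using assms funpow_in_invariant[OF assms(1), of x i] by (simp add: per_def)
qed

lemma birkhoff_funpow: "birkhoff T m n h x = birkhoff T 0 n h ((T ^^ m) x)"
  unfolding birkhoff_def
  by (subst sum.atLeastLessThan_shift_0) (simp add: funpow_add add.commute atLeast0LessThan)

lemma birkhoff_append: "birkhoff T m (n + n') h x = birkhoff T m n h x + birkhoff T (m + n) n' h x"
  by (simp add: birkhoff_def sum.atLeastLessThan_concat add.assoc)

text \<open>
  The orbit of length $k(n+M)$ consists of $k$ blocks of length $n$, each followed by a gap of length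
  $M$. The blocks are numbered from one, which accounts for the predecessor in \<open>block_start\<close>.
\<close>

lemma birkhoff_blocks:
  "birkhoff T 0 (k * (n + M)) h x
    = (\<Sum>i=1..k. birkhoff T (block_start n M i) n h x)
      + (\<Sum>i=1..k. birkhoff T (block_start n M i + n) M h x)"
proof (induction k)
  case 0
  show ?case by (simp add: birkhoff_def)
next
  case (Suc k)
  have "birkhoff T 0 (Suc k * (n + M)) h x
      = birkhoff T 0 (k * (n + M)) h x + birkhoff T (k * (n + M)) (n + M) h x"
    using birkhoff_append[of T 0 "k * (n + M)" "n + M" h x] by (simp add: add.commute)
  also have "birkhoff T (k * (n + M)) (n + M) h x
      = birkhoff T (k * (n + M)) n h x + birkhoff T (k * (n + M) + n) M h x"
    by (rule birkhoff_append)
  finally show ?case using Suc by (simp add: block_start_def)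
qed

section \<open>The coupling of an independent set with its weighted measure\<close>

locale independent_set =
  fixes X :: "'a::metric_space set" and T :: "'a \<Rightarrow> 'a" and \<epsilon> :: real and k n M :: nat
    and \<P> E :: "'a set" and \<Phi> :: "(nat \<Rightarrow> 'a) \<Rightarrow> 'a"
  assumes T_into: "T ` X \<subseteq> X"
    and finite_per: "\<And>m. 0 < m \<Longrightarrow> finite (per X T m)"
    and k_pos: "0 < k" and n_pos: "0 < n"
    and indep: "indep_via X T \<epsilon> k n M \<P> E \<Phi>"
    and P_nonempty: "\<P> \<noteq> {}"
begin

abbreviation N :: nat where "N \<equiv> k * (n + M)"
abbreviation start :: "nat \<Rightarrow> nat" where "start \<equiv> block_start n M"
abbreviation Q :: "'a \<Rightarrow> 'a set" where "Q \<equiv> shadow_set X T \<epsilon> k n M E \<Phi>"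
abbreviation coord :: "'a \<Rightarrow> nat \<Rightarrow> 'a" where "coord \<equiv> inv_into (tuples k E) \<Phi>"
abbreviation \<nu> :: "'a measure" where "\<nu> \<equiv> weighted_measure X T \<epsilon> k n M \<P> E \<Phi>"

lemma N_pos: "0 < N"
  using k_pos n_pos by simp

lemma P_subset: "\<P> \<subseteq> per X T N" and E_subset: "E \<subseteq> per X T (n + M)"
  and bij_\<Phi>: "bij_betw \<Phi> (tuples k E) \<P>"
  using indep by (auto simp: indep_via_def)

lemma finite_P: "finite \<P>" and finite_E: "finite E" and finite_Q: "finite (Q p)"
  using finite_subset[OF P_subset finite_per[OF N_pos]] finite_subset[OF E_subset finite_per] n_pos
    finite_subset[of "Q p" "per X T N"] finite_per[OF N_pos]
  by (auto simp: shadow_set_def)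

lemma bij_coord: "bij_betw coord \<P> (tuples k E)"
  by (rule bij_betw_inv_into[OF bij_\<Phi>])

lemma coord_in_tuples: "p \<in> \<P> \<Longrightarrow> coord p \<in> tuples k E"
  using bij_coord by (auto simp: bij_betw_def)

lemma coord_in_E: "p \<in> \<P> \<Longrightarrow> i \<in> {1..k} \<Longrightarrow> coord p i \<in> E"
  using coord_in_tuples by (rule PiE_mem)

lemma \<Phi>_coord: "p \<in> \<P> \<Longrightarrow> \<Phi> (coord p) = p"
  using bij_\<Phi> by (auto simp: bij_betw_def intro: f_inv_into_f)

lemma E_nonempty: "E \<noteq> {}"
  using P_nonempty coord_in_E k_pos by fastforce

lemma coord_shadows:
  assumes "p \<in> \<P>" "i \<in> {1..k}" "j < n"
  shows "dist ((T ^^ j) (coord p i)) ((T ^^ j) ((T ^^ start i) p)) < \<epsilon>"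
proof -
  have "(T ^^ start i) (\<Phi> (coord p)) \<in> bowen_ball X T n \<epsilon> (coord p i)"
    using indep coord_in_tuples[OF assms(1)] assms(2) unfolding indep_via_def by blast
  then show ?thesis
    using assms \<Phi>_coord[OF assms(1)] n_pos by (simp add: bowen_ball_def bowen_dist_less_iff)
qed

lemma mem_Q_iff:
  "q \<in> Q p \<longleftrightarrow> q \<in> per X T N \<and>
    (\<forall>i\<in>{1..k}. \<forall>j<n. dist ((T ^^ j) ((T ^^ start i) q)) ((T ^^ j) (coord p i)) < 3 * \<epsilon>)"
  using n_pos by (simp add: shadow_set_def bowen_dist_less_iff)

lemma self_in_Q: "p \<in> \<P> \<Longrightarrow> p \<in> Q p"
  unfolding mem_Q_iff using P_subset coord_shadows zero_le_dist
  by (smt (verit) dist_commute subsetD)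

lemma per_subset_per_all: "0 < m \<Longrightarrow> per X T m \<subseteq> per_all X T"
  by (auto simp: per_all_def)

text \<open>
  All points whose Birkhoff sums of length $n$ the coupling compares with the $i$-th block sum of $p$.
\<close>

definition shadow_points :: "nat \<Rightarrow> 'a \<Rightarrow> 'a set" where
  "shadow_points i p = insert (coord p i) ((T ^^ start i) ` Q p)"

text \<open>
  $T^{a_i} p$ is within $\epsilon$ of $x_i$ and $T^{a_i} q$ is within $3\epsilon$ of $x_i$, which is where
  the radius $4\epsilon$ of the oscillation comes from.
\<close>

lemma shadow_points_subset:
  assumes "p \<in> \<P>" "i \<in> {1..k}"
  shows "shadow_points i p \<subseteq> bowen_ball X T n (4 * \<epsilon>) ((T ^^ start i) p) \<inter> per_all X T"
proof -
  have "coord p i \<in> per X T (n + M)" using coord_in_E[OF assms] E_subset by auto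
  then have 1: "coord p i \<in> X" "coord p i \<in> per_all X T"
    using per_subset_per_all[of "n + M"] n_pos by (auto simp: per_def)
  have 2: "(T ^^ start i) q \<in> X" "(T ^^ start i) q \<in> per_all X T" if "q \<in> Q p" for q
  proof -
    have "(T ^^ start i) q \<in> per X T N"
      using that by (intro funpow_in_per[OF T_into]) (simp add: mem_Q_iff)
    then show "(T ^^ start i) q \<in> X" "(T ^^ start i) q \<in> per_all X T"
      using per_subset_per_all[OF N_pos] by (auto simp: per_def)
  qed
  have 3: "dist ((T ^^ j) ((T ^^ start i) p)) ((T ^^ j) (coord p i)) < 4 * \<epsilon>" if "j < n" for j
    using coord_shadows[OF assms that] zero_le_dist by (smt (verit) dist_commute)
  have 4: "dist ((T ^^ j) ((T ^^ start i) p)) ((T ^^ j) ((T ^^ start i) q)) < 4 * \<epsilon>"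
    if "j < n" "q \<in> Q p" for j q
    using coord_shadows[OF assms that(1)] that assms(2) unfolding mem_Q_iff
    by (smt (verit) dist_commute dist_triangle)
  show ?thesis
    using 1 2 3 4 n_pos by (auto simp: shadow_points_def bowen_ball_def bowen_dist_less_iff)
qed

text \<open>
  The coupling: integrating against the weighted measure is averaging over $p$ and then over its shadow
  set. This is the definition of the weights with the two summations exchanged.
\<close>

lemma integral_\<nu>:
  fixes f :: "'a \<Rightarrow> 'b::{banach, second_countable_topology}"
  shows "integral\<^sup>L \<nu> f = average \<P> (\<lambda>p. average (Q p) f)"
proof -
  let ?w = "\<lambda>p q. if q \<in> Q p then 1 / real (card (Q p)) else 0"
  have weight_eq: "weight X T \<epsilon> k n M \<P> E \<Phi> q = (\<Sum>p\<in>\<P>. ?w p q) / card \<P>" for q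
    using finite_P by (simp add: weight_def sum.inter_filter)
  have "integral\<^sup>L \<nu> f = (\<Sum>q\<in>per X T N. weight X T \<epsilon> k n M \<P> E \<Phi> q *\<^sub>R f q)"
    unfolding weighted_measure_def
    by (intro lebesgue_integral_point_measure_finite finite_per N_pos)
      (simp add: weight_eq sum_nonneg)
  also have "\<dots> = (\<Sum>q\<in>per X T N. \<Sum>p\<in>\<P>. (?w p q / card \<P>) *\<^sub>R f q)"
    by (simp add: weight_eq sum_divide_distrib scaleR_sum_left)
  also have "\<dots> = (\<Sum>p\<in>\<P>. \<Sum>q\<in>per X T N. (?w p q / card \<P>) *\<^sub>R f q)"
    by (rule sum.swap)
  also have "\<dots> = (\<Sum>p\<in>\<P>. average (Q p) f /\<^sub>R card \<P>)"
  proof (rule sum.cong[OF refl])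
    fix p
    have "(\<Sum>q\<in>per X T N. (?w p q / card \<P>) *\<^sub>R f q)
        = (\<Sum>q\<in>Q p. (1 / card (Q p) / card \<P>) *\<^sub>R f q)"
      using finite_per[OF N_pos] by (intro sum.mono_neutral_cong_right) (auto simp: mem_Q_iff)
    then show "(\<Sum>q\<in>per X T N. (?w p q / card \<P>) *\<^sub>R f q) = average (Q p) f /\<^sub>R card \<P>"
      by (simp add: average_def scaleR_sum_right inverse_eq_divide mult.commute)
  qed
  finally show ?thesis by (simp add: average_def[of \<P>] scaleR_sum_right)
qed

lemma space_\<nu>: "space \<nu> = per X T N" and sets_\<nu>: "sets \<nu> = Pow (per X T N)"
  by (simp_all add: weighted_measure_def space_point_measure sets_point_measure)

lemma prob_space_\<nu>: "prob_space \<nu>"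
proof -
  have fin: "emeasure \<nu> (space \<nu>) < \<infinity>"
    unfolding space_\<nu>
    unfolding weighted_measure_def
    using finite_per[OF N_pos] by (simp add: emeasure_point_measure_finite)
  have "measure \<nu> (space \<nu>) = integral\<^sup>L \<nu> (\<lambda>_. 1::real)" by simp
  also have "\<dots> = average \<P> (\<lambda>p. average (Q p) (\<lambda>_. 1::real))" by (rule integral_\<nu>)
  also have "\<dots> = average \<P> (\<lambda>p. 1::real)"
    using finite_Q self_in_Q by (intro average_cong) (auto intro!: average_const)
  finally have "measure \<nu> (space \<nu>) = 1" using finite_P P_nonempty by (simp add: average_const)
  then show ?thesis
    using fin by (intro prob_spaceI) (simp add: emeasure_eq_ennreal_measure)
qed

context
  fixes h :: "'a \<Rightarrow> real"
begin

text \<open>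
  The part of the oscillation that the coupling sees. As a maximum over finitely many points
  it is a real number even where the oscillation is infinite, so that all estimates can be
  made in the reals. The same holds for \<open>gap_bound\<close> with respect to the supremum norm.
\<close>

definition deviation :: "nat \<Rightarrow> 'a \<Rightarrow> real" where
  "deviation i p = (MAX y\<in>shadow_points i p. \<bar>birkhoff T (start i) n h p - birkhoff T 0 n h y\<bar>)"

definition gap_bound :: real where
  "gap_bound = (MAX q\<in>per X T N. \<bar>\<Sum>i=1..k. birkhoff T (start i + n) M h q\<bar>)"

lemma finite_shadow_points: "finite (shadow_points i p)"
  by (simp add: shadow_points_def finite_Q)

lemma deviation_ge:
  "y \<in> shadow_points i p \<Longrightarrow> \<bar>birkhoff T (start i) n h p - birkhoff T 0 n h y\<bar> \<le> deviation i p"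
  unfolding deviation_def using finite_shadow_points by (intro Max_ge) auto

lemma deviation_nonneg: "0 \<le> deviation i p"
  using deviation_ge[of "coord p i" i p] by (simp add: shadow_points_def)

lemma deviation_le_oscillation:
  assumes "p \<in> \<P>" "i \<in> {1..k}"
  shows "ennreal (deviation i p) \<le> oscillation X T (start i) n h (4 * \<epsilon>) p"
proof -
  have "deviation i p \<in> (\<lambda>y. \<bar>birkhoff T (start i) n h p - birkhoff T 0 n h y\<bar>) ` shadow_points i p"
    unfolding deviation_def by (intro Max_in) (auto simp: finite_shadow_points, simp add: shadow_points_def)
  then show ?thesis
    using shadow_points_subset[OF assms] by (auto simp: oscillation_def intro!: SUP_upper)
qed

lemma gap_bound_ge: "q \<in> per X T N \<Longrightarrow> \<bar>\<Sum>i=1..k. birkhoff T (start i + n) M h q\<bar> \<le> gap_bound"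
  unfolding gap_bound_def using finite_per[OF N_pos] by (intro Max_ge) auto

lemma per_N_nonempty: "per X T N \<noteq> {}"
  using P_subset P_nonempty by blast

lemma gap_bound_nonneg: "0 \<le> gap_bound"
  using per_N_nonempty gap_bound_ge abs_ge_zero by (metis all_not_in_conv order_trans)

lemma gap_bound_le: "ennreal gap_bound \<le> of_nat k * (of_nat M * sup_norm X T h)"
proof -
  have "gap_bound \<in> (\<lambda>q. \<bar>\<Sum>i=1..k. birkhoff T (start i + n) M h q\<bar>) ` per X T N"
    unfolding gap_bound_def using finite_per[OF N_pos] per_N_nonempty by (intro Max_in) auto
  then obtain q where q: "q \<in> per X T N" "gap_bound = \<bar>\<Sum>i=1..k. birkhoff T (start i + n) M h q\<bar>"
    by auto
  have h_le: "ennreal \<bar>h ((T ^^ j) q)\<bar> \<le> sup_norm X T h" for j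
    unfolding sup_norm_def using per_subset_per_all[OF N_pos] funpow_in_per[OF T_into q(1)]
    by (intro SUP_upper) auto
  have "gap_bound \<le> (\<Sum>i=1..k. \<Sum>j\<in>{start i + n..<start i + n + M}. \<bar>h ((T ^^ j) q)\<bar>)"
    unfolding q(2) birkhoff_def by (intro order_trans[OF sum_abs] sum_mono) auto
  then have "ennreal gap_bound \<le> ennreal (\<Sum>i=1..k. \<Sum>j\<in>{start i + n..<start i + n + M}. \<bar>h ((T ^^ j) q)\<bar>)"
    by (rule ennreal_leI)
  also have "\<dots> = (\<Sum>i=1..k. \<Sum>j\<in>{start i + n..<start i + n + M}. ennreal \<bar>h ((T ^^ j) q)\<bar>)"
    by (simp add: sum_nonneg flip: sum_ennreal)
  also have "\<dots> \<le> (\<Sum>i=1..k. \<Sum>j\<in>{start i + n..<start i + n + M}. sup_norm X T h)"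
    by (intro sum_mono h_le)
  also have "\<dots> = of_nat k * (of_nat M * sup_norm X T h)"
    by simp
  finally show ?thesis .
qed

text \<open>
  Both $S_{a_i}^n h(q)$ and $S^n h(x_i)$ are compared with $S_{a_i}^n h(p)$, hence the factor 2.
\<close>

lemma birkhoff_coupling:
  assumes p: "p \<in> \<P>" and q: "q \<in> Q p"
  shows "\<bar>birkhoff T 0 N h q - (\<Sum>i=1..k. birkhoff T 0 n h (coord p i))\<bar>
    \<le> gap_bound + 2 * (\<Sum>i=1..k. deviation i p)"
proof -
  let ?G = "\<Sum>i=1..k. birkhoff T (start i + n) M h q"
  have "\<bar>birkhoff T (start i) n h q - birkhoff T 0 n h (coord p i)\<bar> \<le> 2 * deviation i p" for i
    using deviation_ge[of "coord p i" i p] deviation_ge[of "(T ^^ start i) q" i p] q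
    unfolding birkhoff_funpow[of T "start i" n h q] by (simp add: shadow_points_def)
  then have "\<bar>\<Sum>i=1..k. birkhoff T (start i) n h q - birkhoff T 0 n h (coord p i)\<bar>
      \<le> (\<Sum>i=1..k. 2 * deviation i p)"
    by (intro order_trans[OF sum_abs] sum_mono)
  moreover have "\<bar>?G\<bar> \<le> gap_bound" using q by (intro gap_bound_ge) (simp add: mem_Q_iff)
  moreover have "birkhoff T 0 N h q - (\<Sum>i=1..k. birkhoff T 0 n h (coord p i))
      = (\<Sum>i=1..k. birkhoff T (start i) n h q - birkhoff T 0 n h (coord p i)) + ?G"
    by (simp add: birkhoff_blocks sum_subtractf)
  ultimately show ?thesis by (simp add: sum_distrib_left)
qed


lemma average_coord:
  fixes F :: "'a \<Rightarrow> real"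
  assumes "i \<in> {1..k}"
  shows "average \<P> (\<lambda>p. F (coord p i)) = average E F"
  using average_reindex[OF bij_coord, of "\<lambda>x. F (x i)"]
    average_tuples_coordinate[OF finite_E E_nonempty assms] by simp

lemma average_iexp_sum_coord:
  fixes f :: "'a \<Rightarrow> real"
  shows "average \<P> (\<lambda>p. iexp (t * (\<Sum>i=1..k. f (coord p i)))) = average E (\<lambda>e. iexp (t * f e)) ^ k"
  using average_reindex[OF bij_coord, of "\<lambda>x. iexp (t * (\<Sum>i=1..k. f (x i)))"]
    average_iexp_sum_tuples[OF finite_E] by simp

lemma unif_variance_coord:
  "i \<in> {1..k} \<Longrightarrow> unif_variance \<P> (\<lambda>p. g (coord p i)) = unif_variance E g"
  unfolding unif_variance_eq_average[OF finite_P] unif_variance_eq_average[OF finite_E]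
  by (simp only: average_coord average_coord[where F = "\<lambda>e. (g e - average E g)\<^sup>2"])

lemma lindeberg_coord:
  "i \<in> {1..k} \<Longrightarrow> lindeberg \<P> (\<lambda>p. g (coord p i)) \<eta> = lindeberg E g \<eta>"
  unfolding lindeberg_eq_average[OF finite_P] lindeberg_eq_average[OF finite_E]
  by (simp only: average_coord average_coord[where F = "\<lambda>e. if \<eta> < \<bar>g e - average E g\<bar> then (g e - average E g)\<^sup>2 else 0"])

lemma average_deviation_square:
  "average \<P> (\<lambda>p. (birkhoff T 0 n h (coord p i) - birkhoff T (start i) n h p)\<^sup>2)
    \<le> average \<P> (\<lambda>p. (deviation i p)\<^sup>2)"
proof (rule average_mono)
  fix p
  have "\<bar>birkhoff T 0 n h (coord p i) - birkhoff T (start i) n h p\<bar> \<le> \<bar>deviation i p\<bar>"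
    using deviation_ge[of "coord p i" i p] by (simp add: shadow_points_def abs_minus_commute)
  then show "(birkhoff T 0 n h (coord p i) - birkhoff T (start i) n h p)\<^sup>2 \<le> (deviation i p)\<^sup>2"
    by (simp only: abs_le_square_iff)
qed

lemma variance_comparison:
  assumes "0 < \<theta>"
  shows "\<bar>real k * unif_variance E (birkhoff T 0 n h)
        - (\<Sum>i=1..k. unif_variance \<P> (birkhoff T (start i) n h))\<bar>
    \<le> \<theta> * (\<Sum>i=1..k. unif_variance \<P> (birkhoff T (start i) n h))
      + (1 + 1 / \<theta>) * (\<Sum>i=1..k. average \<P> (\<lambda>p. (deviation i p)\<^sup>2))"
proof -
  let ?g = "birkhoff T 0 n h" and ?V = "\<lambda>i. unif_variance \<P> (birkhoff T (start i) n h)"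
  have "\<bar>real k * unif_variance E ?g - (\<Sum>i=1..k. ?V i)\<bar>
      = \<bar>\<Sum>i=1..k. unif_variance \<P> (\<lambda>p. ?g (coord p i)) - ?V i\<bar>"
    using sum.cong[OF refl unif_variance_coord[where g = ?g], of "{1..k}"] by (simp add: sum_subtractf)
  also have "\<dots> \<le> (\<Sum>i=1..k. \<theta> * ?V i + (1 + 1 / \<theta>) * average \<P> (\<lambda>p. (deviation i p)\<^sup>2))"
  proof (intro order_trans[OF sum_abs] sum_mono)
    fix i
    have "0 \<le> 1 + 1 / \<theta>" using assms by simp
    then show "\<bar>unif_variance \<P> (\<lambda>p. ?g (coord p i)) - ?V i\<bar>
        \<le> \<theta> * ?V i + (1 + 1 / \<theta>) * average \<P> (\<lambda>p. (deviation i p)\<^sup>2)"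
      using unif_variance_perturb[OF finite_P P_nonempty assms,
          of "\<lambda>p. ?g (coord p i)" "birkhoff T (start i) n h"]
        mult_left_mono[OF average_deviation_square[of i]] by fastforce
  qed
  finally show ?thesis by (simp add: sum.distrib sum_distrib_left)
qed

lemma lindeberg_comparison:
  assumes "0 < \<eta>"
  shows "real k * lindeberg E (birkhoff T 0 n h) \<eta>
    \<le> 4 * (\<Sum>i=1..k. lindeberg \<P> (birkhoff T (start i) n h) (\<eta> / 2))
      + 4 * (\<Sum>i=1..k. average \<P> (\<lambda>p. (deviation i p)\<^sup>2))"
proof -
  let ?g = "birkhoff T 0 n h"
  have "real k * lindeberg E ?g \<eta> = (\<Sum>i=1..k. lindeberg \<P> (\<lambda>p. ?g (coord p i)) \<eta>)"
    using sum.cong[OF refl lindeberg_coord[where g = ?g and \<eta> = \<eta>], of "{1..k}"] by simp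
  also have "\<dots> \<le> (\<Sum>i=1..k. 4 * lindeberg \<P> (birkhoff T (start i) n h) (\<eta> / 2)
      + 4 * average \<P> (\<lambda>p. (deviation i p)\<^sup>2))"
  proof (rule sum_mono)
    fix i
    show "lindeberg \<P> (\<lambda>p. ?g (coord p i)) \<eta>
      \<le> 4 * lindeberg \<P> (birkhoff T (start i) n h) (\<eta> / 2) + 4 * average \<P> (\<lambda>p. (deviation i p)\<^sup>2)"
      using lindeberg_perturb[OF finite_P P_nonempty assms,
          of "\<lambda>p. ?g (coord p i)" "birkhoff T (start i) n h"] average_deviation_square[of i]
      by linarith
  qed
  finally show ?thesis by (simp add: sum.distrib sum_distrib_left)
qed

text \<open>
  By \<open>birkhoff_coupling\<close> the uncentred sums differ by at most
  \<open>D p\<close>, and so their expectations differ by at most the average of \<open>D\<close>. The centred sums are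
  therefore within twice that average of each other in mean, and the exponential is Lipschitz.
\<close>

lemma char_comparison:
  assumes s: "0 < s"
  defines "W \<equiv> \<lambda>q. (birkhoff T 0 N h q - integral\<^sup>L \<nu> (birkhoff T 0 N h)) / s"
    and "f \<equiv> \<lambda>e. (birkhoff T 0 n h e - average E (birkhoff T 0 n h)) / s"
  shows "cmod (char (distr \<nu> borel W) t - average E (\<lambda>e. iexp (t * f e)) ^ k)
    \<le> 2 * \<bar>t\<bar> * (gap_bound / s + 2 * (\<Sum>i=1..k. average \<P> (deviation i)) / s)"
proof -
  define S where "S = birkhoff T 0 N h"
  define R where "R p = (\<Sum>i=1..k. birkhoff T 0 n h (coord p i))" for p
  define D where "D p = gap_bound + 2 * (\<Sum>i=1..k. deviation i p)" for p
  define m where "m = integral\<^sup>L \<nu> S"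
  define r where "r = average \<P> R"
  have Q_ne: "Q p \<noteq> {}" if "p \<in> \<P>" for p using self_in_Q[OF that] by auto
  have SR: "\<bar>S q - R p\<bar> \<le> D p" if "p \<in> \<P>" "q \<in> Q p" for p q
    using birkhoff_coupling[OF that] by (simp add: S_def R_def D_def)
  have "\<bar>m - r\<bar> = \<bar>average \<P> (\<lambda>p. average (Q p) (\<lambda>q. S q - R p))\<bar>"
  proof -
    have "average \<P> (\<lambda>p. average (Q p) (\<lambda>q. S q - R p)) = average \<P> (\<lambda>p. average (Q p) S - R p)"
      by (intro average_cong) (simp add: average_diff average_const finite_Q Q_ne)
    then show ?thesis by (simp add: m_def r_def integral_\<nu> average_diff)
  qed
  also have "\<dots> \<le> average \<P> (\<lambda>p. \<bar>average (Q p) (\<lambda>q. S q - R p)\<bar>)"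
    by (rule norm_average_le[of \<P> "\<lambda>p. average (Q p) (\<lambda>q. S q - R p)", unfolded real_norm_def])
  also have "\<dots> \<le> average \<P> (\<lambda>p. average (Q p) (\<lambda>q. \<bar>S q - R p\<bar>))"
    by (rule average_mono) (rule norm_average_le[where 'b = real, unfolded real_norm_def])
  also have "\<dots> \<le> average \<P> (\<lambda>p. average (Q p) (\<lambda>q. D p))"
    by (intro average_mono SR)
  also have "\<dots> = average \<P> D"
    by (intro average_cong) (simp add: average_const finite_Q Q_ne)
  finally have mean_diff: "\<bar>m - r\<bar> \<le> average \<P> D" .
  have r: "r = real k * average E (birkhoff T 0 n h)"
  proof -
    have "r = (\<Sum>i=1..k. average \<P> (\<lambda>p. birkhoff T 0 n h (coord p i)))"
      unfolding r_def R_def[abs_def] by (rule average_sum)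
    also have "\<dots> = (\<Sum>i=1..k. average E (birkhoff T 0 n h))"
      by (intro sum.cong refl average_coord)
    finally show ?thesis by simp
  qed
  have sum_f: "(\<Sum>i=1..k. f (coord p i)) = (R p - r) / s" for p
    by (simp add: f_def R_def r sum_divide_distrib[symmetric] sum_subtractf)
  have pt: "cmod (iexp (t * W q) - iexp (t * ((R p - r) / s))) \<le> \<bar>t\<bar> * ((D p + average \<P> D) / s)"
    if "p \<in> \<P>" "q \<in> Q p" for p q
  proof -
    have "W q = (S q - m) / s" by (simp add: W_def S_def m_def)
    then have "t * W q - t * ((R p - r) / s) = t * (((S q - R p) - (m - r)) / s)"
      by (simp add: diff_divide_distrib right_diff_distrib)
    then have "cmod (iexp (t * W q) - iexp (t * ((R p - r) / s))) \<le> \<bar>t * (((S q - R p) - (m - r)) / s)\<bar>"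
      using cmod_iexp_diff_le[of "t * W q" "t * ((R p - r) / s)"] by simp
    also have "\<dots> = \<bar>t\<bar> * (\<bar>(S q - R p) - (m - r)\<bar> / s)" using s by (simp add: abs_mult)
    also have "\<dots> \<le> \<bar>t\<bar> * ((D p + average \<P> D) / s)"
      using SR[OF that] mean_diff s by (intro mult_left_mono divide_right_mono) auto
    finally show ?thesis .
  qed
  have meas: "W \<in> borel_measurable \<nu>"
    by (simp add: measurable_def sets_\<nu> space_\<nu>)
  have "char (distr \<nu> borel W) t = average \<P> (\<lambda>p. average (Q p) (\<lambda>q. iexp (t * W q)))"
    unfolding char_def using meas by (subst integral_distr) (simp_all add: integral_\<nu>)
  moreover have "average E (\<lambda>e. iexp (t * f e)) ^ k
      = average \<P> (\<lambda>p. average (Q p) (\<lambda>q. iexp (t * ((R p - r) / s))))"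
    \<comment> \<open>The average over \<open>Q p\<close> of a quantity that depends on \<open>p\<close> alone is inserted, to match the coupling.\<close>
    unfolding average_iexp_sum_coord[symmetric] sum_f
    by (intro average_cong) (simp add: average_const finite_Q Q_ne)
  ultimately have "cmod (char (distr \<nu> borel W) t - average E (\<lambda>e. iexp (t * f e)) ^ k)
      = cmod (average \<P> (\<lambda>p. average (Q p) (\<lambda>q. iexp (t * W q) - iexp (t * ((R p - r) / s)))))"
    by (simp only: average_diff)
  also have "\<dots> \<le> average \<P> (\<lambda>p. cmod (average (Q p) (\<lambda>q. iexp (t * W q) - iexp (t * ((R p - r) / s)))))"
    by (rule norm_average_le)
  also have "\<dots> \<le> average \<P> (\<lambda>p. average (Q p) (\<lambda>q. \<bar>t\<bar> * ((D p + average \<P> D) / s)))"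
    by (intro average_mono order_trans[OF norm_average_le] pt)
  also have "\<dots> = average \<P> (\<lambda>p. \<bar>t\<bar> * ((D p + average \<P> D) / s))"
    by (intro average_cong) (simp add: average_const finite_Q Q_ne)
  also have "\<dots> = 2 * \<bar>t\<bar> * (average \<P> D / s)"
    by (simp add: average_scale average_divide average_add average_const finite_P P_nonempty)
  also have "average \<P> D = gap_bound + 2 * (\<Sum>i=1..k. average \<P> (deviation i))"
    unfolding D_def[abs_def] by (simp add: average_scale average_add average_const average_sum finite_P P_nonempty)
  finally show ?thesis by (simp add: add_divide_distrib)
qed

lemma average_deviation_le_oscillation:
  assumes s: "0 < s"
  shows "ennreal ((\<Sum>i=1..k. average \<P> (\<lambda>p. deviation i p ^ j)) / s ^ j)
    \<le> (\<Sum>i=1..k. \<integral>\<^sup>+p. oscillation X T (start i) n h (4 * \<epsilon>) p ^ j \<partial>uniform_count_measure \<P>)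
      / ennreal (s ^ j)"
proof -
  have le: "ennreal (average \<P> (\<lambda>p. deviation i p ^ j))
      \<le> (\<integral>\<^sup>+p. oscillation X T (start i) n h (4 * \<epsilon>) p ^ j \<partial>uniform_count_measure \<P>)"
    if "i \<in> {1..k}" for i
  proof -
    have "integrable (uniform_count_measure \<P>) (\<lambda>p. deviation i p ^ j)"
      by (simp add: uniform_count_measure_def integrable_point_measure_finite finite_P)
    then have "ennreal (average \<P> (\<lambda>p. deviation i p ^ j))
        = (\<integral>\<^sup>+p. ennreal (deviation i p ^ j) \<partial>uniform_count_measure \<P>)"
      by (subst nn_integral_eq_integral)
        (auto simp: integral_uniform_count_measure_eq_average finite_P deviation_nonneg)
    also have "\<dots> \<le> (\<integral>\<^sup>+p. oscillation X T (start i) n h (4 * \<epsilon>) p ^ j \<partial>uniform_count_measure \<P>)"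
      using deviation_le_oscillation[OF _ that]
      by (intro nn_integral_mono)
        (simp add: space_uniform_count_measure deviation_nonneg power_mono flip: ennreal_power)
    finally show ?thesis .
  qed
  have "ennreal ((\<Sum>i=1..k. average \<P> (\<lambda>p. deviation i p ^ j)) / s ^ j)
      = (\<Sum>i=1..k. ennreal (average \<P> (\<lambda>p. deviation i p ^ j))) / ennreal (s ^ j)"
    using s by (simp add: divide_ennreal[symmetric] sum_nonneg average_nonneg deviation_nonneg)
  also have "\<dots> \<le> (\<Sum>i=1..k. \<integral>\<^sup>+p. oscillation X T (start i) n h (4 * \<epsilon>) p ^ j \<partial>uniform_count_measure \<P>)
      / ennreal (s ^ j)"
    by (intro divide_right_mono_ennreal sum_mono le)
  finally show ?thesis .
qed

lemma gap_bound_square_le: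
  assumes s: "0 < s"
  shows "ennreal ((gap_bound / s)\<^sup>2) \<le> of_nat k ^ 2 * of_nat M ^ 2 * sup_norm X T h ^ 2 / ennreal (s\<^sup>2)"
proof -
  have "ennreal ((gap_bound / s)\<^sup>2) = ennreal gap_bound ^ 2 / ennreal (s\<^sup>2)"
    using s gap_bound_nonneg by (simp add: power_divide divide_ennreal ennreal_power)
  also have "\<dots> \<le> (of_nat k * (of_nat M * sup_norm X T h)) ^ 2 / ennreal (s\<^sup>2)"
    by (intro divide_right_mono_ennreal power_mono gap_bound_le) auto
  finally show ?thesis by (simp add: power_mult_distrib mult.assoc)
qed

end

end

section \<open>The central limit theorem\<close>

lemma real_tendsto_0_of_ennreal_bound:
  fixes f :: "nat \<Rightarrow> real"
  assumes "\<And>l. 0 \<le> f l" "\<And>l. ennreal (f l) \<le> F l" "F \<longlonglongrightarrow> 0"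
  shows "f \<longlonglongrightarrow> 0"
proof -
  have "(\<lambda>l. ennreal (f l)) \<longlonglongrightarrow> ennreal 0"
    using tendsto_sandwich[OF _ _ tendsto_const assms(3), of "\<lambda>l. ennreal (f l)"] assms(2) by simp
  then show ?thesis by (rule tendsto_ennrealD) (simp_all add: assms(1))
qed

lemma weak_conv_std_normal_cdf:
  assumes "weak_conv_m \<mu> std_normal_distribution"
  shows "(\<lambda>l. cdf (\<mu> l) t) \<longlonglongrightarrow> cdf std_normal_distribution t"
proof -
  interpret real_distribution std_normal_distribution by (rule real_dist_normal_dist)
  have "emeasure std_normal_distribution {t} = 0"
    by (subst emeasure_density) (auto simp: nn_integral_null_set)
  then have "isCont (cdf std_normal_distribution) t"
    by (simp add: isCont_cdf measure_def)
  then show ?thesis using assms by (simp add: weak_conv_m_def weak_conv_def)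
qed

theorem corollary3p5:
  fixes X :: "'a::metric_space set"
    and T :: "'a \<Rightarrow> 'a"
    and \<epsilon> :: "nat \<Rightarrow> real"
    and M k n :: "nat \<Rightarrow> nat"
    and \<P> E :: "nat \<Rightarrow> 'a set"
    and \<Phi> :: "nat \<Rightarrow> (nat \<Rightarrow> 'a) \<Rightarrow> 'a"
    and h :: "nat \<Rightarrow> 'a \<Rightarrow> real"
    and a :: "nat \<Rightarrow> nat \<Rightarrow> nat"
    and s :: "nat \<Rightarrow> real"
    and \<nu> :: "nat \<Rightarrow> 'a measure"
  assumes compact_X: "compact X"
    and cont_T: "continuous_on X T"
    and T_into: "T ` X \<subseteq> X"
    and finite_per: "\<And>m. 0 < m \<Longrightarrow> finite (per X T m)"
    and eps_pos: "\<And>l. 0 < \<epsilon> l"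
    and k_pos: "\<And>l. 0 < k l"
    and n_pos: "\<And>l. 0 < n l"
    and k_lim: "filterlim k at_top sequentially"
    and indep: "\<And>l. indep_via X T (\<epsilon> l) (k l) (n l) (M l) (\<P> l) (E l) (\<Phi> l)"
    and nu: "\<And>l. \<nu> l = weighted_measure X T (\<epsilon> l) (k l) (n l) (M l) (\<P> l) (E l) (\<Phi> l)"
    and a: "\<And>l i. a l i = block_start (n l) (M l) i"
    and s_pos: "\<And>l. 0 < s l"
    and s_sq: "\<And>l. (s l)\<^sup>2 = (\<Sum>i=1..k l. unif_variance (\<P> l) (birkhoff T (a l i) (n l) (h l)))"
    and osc: "\<And>j. j \<in> {1, 2::nat} \<Longrightarrow>
      (\<lambda>l. (\<Sum>i=1..k l. \<integral>\<^sup>+p. (oscillation X T (a l i) (n l) (h l) (4 * \<epsilon> l) p) ^ j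
                \<partial>uniform_count_measure (\<P> l)) / ennreal ((s l) ^ j)) \<longlonglongrightarrow> 0"
    and gap: "(\<lambda>l. of_nat (k l) ^ 2 * of_nat (M l) ^ 2 * (sup_norm X T (h l)) ^ 2
                     / ennreal ((s l)\<^sup>2)) \<longlonglongrightarrow> 0"
    and lindeberg: "\<And>\<eta>. 0 < \<eta> \<Longrightarrow>
      (\<lambda>l. 1 / (s l)\<^sup>2 * (\<Sum>i=1..k l. lindeberg (\<P> l) (birkhoff T (a l i) (n l) (h l)) (\<eta> * s l)))
        \<longlonglongrightarrow> 0"
  shows "\<forall>t. (\<lambda>l. measure (\<nu> l)
            {q \<in> space (\<nu> l).
               birkhoff T 0 (k l * (n l + M l)) (h l) q
                 - (\<integral>x. birkhoff T 0 (k l * (n l + M l)) (h l) x \<partial>(\<nu> l)) \<le> t * s l})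
          \<longlonglongrightarrow> cdf std_normal_distribution t"
proof
  fix t
  have P_ne: "\<P> l \<noteq> {}" for l
  proof
    assume "\<P> l = {}"
    \<comment> \<open>All averages over the empty set vanish, which contradicts the positivity of the normalisation.\<close>
    then have "(s l)\<^sup>2 = 0" by (simp add: s_sq unif_variance_eq_average average_def)
    then show False using s_pos[of l] by simp
  qed
  interpret IS: independent_set X T "\<epsilon> l" "k l" "n l" "M l" "\<P> l" "E l" "\<Phi> l" for l
    by (unfold_locales; fact T_into finite_per k_pos n_pos indep P_ne)
  define g where "g l = birkhoff T 0 (n l) (h l)" for l
  \<comment> \<open>The normalised errors of the coupling: inside the blocks, in $L^j$, and in the gaps.\<close>
  define \<delta> where "\<delta> j l = (\<Sum>i=1..k l. average (\<P> l) (\<lambda>p. IS.deviation l (h l) i p ^ j)) / s l ^ j" for j l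
  define \<gamma> where "\<gamma> l = IS.gap_bound l (h l) / s l" for l
  have \<delta>_lim: "\<delta> j \<longlonglongrightarrow> 0" if "j \<in> {1, 2}" for j
  proof (rule real_tendsto_0_of_ennreal_bound[OF _ _ osc[OF that]])
    show "0 \<le> \<delta> j l" for l
      unfolding \<delta>_def using s_pos[of l]
      by (intro divide_nonneg_pos sum_nonneg average_nonneg) (auto simp: IS.deviation_nonneg)
    show "ennreal (\<delta> j l) \<le> (\<Sum>i=1..k l. \<integral>\<^sup>+p. (oscillation X T (a l i) (n l) (h l) (4 * \<epsilon> l) p) ^ j
                \<partial>uniform_count_measure (\<P> l)) / ennreal ((s l) ^ j)" for l
      unfolding \<delta>_def a by (rule IS.average_deviation_le_oscillation[OF s_pos])
  qed
  have \<gamma>_lim: "\<gamma> \<longlonglongrightarrow> 0"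
  proof -
    have "(\<lambda>l. (\<gamma> l)\<^sup>2) \<longlonglongrightarrow> 0"
      by (rule real_tendsto_0_of_ennreal_bound[OF _ _ gap])
        (simp_all add: \<gamma>_def IS.gap_bound_square_le[OF s_pos])
    then show ?thesis by (simp add: power_tendsto_0_iff)
  qed

  \<comment> \<open>The summands of the array: each row consists of \<open>k l\<close> independent copies of \<open>f l\<close> under the uniform measure on \<open>E l\<close>.\<close>
  define f where "f l e = (g l e - average (E l) (g l)) / s l" for l e
  have f_mean: "average (E l) (f l) = 0" for l
    using IS.finite_E[of l] IS.E_nonempty[of l]
    by (simp add: f_def[abs_def] average_divide average_diff average_const)
  have f_var: "real (k l) * average (E l) (\<lambda>e. (f l e)\<^sup>2) = real (k l) * unif_variance (E l) (g l) / (s l)\<^sup>2" for l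
    by (simp add: f_def power_divide average_divide unif_variance_eq_average IS.finite_E)
  have f_lind: "real (k l) * average (E l) (\<lambda>e. if \<bar>f l e\<bar> > \<eta> then (f l e)\<^sup>2 else 0)
      = real (k l) * Defs.lindeberg (E l) (g l) (\<eta> * s l) / (s l)\<^sup>2" for l \<eta>
  proof -
    have "(if \<bar>f l e\<bar> > \<eta> then (f l e)\<^sup>2 else 0)
        = (if \<bar>g l e - average (E l) (g l)\<bar> > \<eta> * s l then (g l e - average (E l) (g l))\<^sup>2 else 0) / (s l)\<^sup>2" for e
      using s_pos[of l] by (simp add: f_def power_divide pos_less_divide_eq)
    then show ?thesis by (simp only: lindeberg_eq_average[OF IS.finite_E] average_divide) simp
  qed

  have var_lim: "(\<lambda>l. real (k l) * average (E l) (\<lambda>e. (f l e)\<^sup>2)) \<longlonglongrightarrow> 1"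
  proof (rule tendstoI, unfold dist_real_def)
    \<comment> \<open>The parameter \<open>\<theta>\<close> of \<open>variance_comparison\<close> is \<open>r / 2\<close>; this leaves room for the term that vanishes with \<open>\<delta> 2\<close>.\<close>
    fix r :: real assume r: "0 < r"
    have "(\<lambda>l. r / 2 + (1 + 1 / (r / 2)) * \<delta> 2 l) \<longlonglongrightarrow> r / 2 + (1 + 1 / (r / 2)) * 0"
      by (intro tendsto_intros \<delta>_lim) simp
    then have "\<forall>\<^sub>F l in sequentially. r / 2 + (1 + 1 / (r / 2)) * \<delta> 2 l < r"
      by (rule order_tendstoD) (use r in simp)
    then show "\<forall>\<^sub>F l in sequentially. \<bar>real (k l) * average (E l) (\<lambda>e. (f l e)\<^sup>2) - 1\<bar> < r"
    proof eventually_elim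
      case (elim l)
      have "\<bar>real (k l) * unif_variance (E l) (g l) - (s l)\<^sup>2\<bar>
          \<le> r / 2 * (s l)\<^sup>2 + (1 + 1 / (r / 2)) * (\<delta> 2 l * (s l)\<^sup>2)"
        using IS.variance_comparison[of "r / 2" l "h l", folded a] r s_pos[of l]
        by (simp only: s_sq[symmetric] g_def \<delta>_def) simp
      also have "\<dots> < r * (s l)\<^sup>2"
        using mult_strict_right_mono[OF elim, of "(s l)\<^sup>2"] s_pos[of l] by (simp add: algebra_simps)
      finally have "\<bar>real (k l) * unif_variance (E l) (g l) - (s l)\<^sup>2\<bar> / (s l)\<^sup>2 < r"
        using s_pos[of l] by (simp add: pos_divide_less_eq)
      moreover have "real (k l) * unif_variance (E l) (g l) / (s l)\<^sup>2 - 1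
          = (real (k l) * unif_variance (E l) (g l) - (s l)\<^sup>2) / (s l)\<^sup>2"
        using s_pos[of l] by (simp add: diff_divide_distrib)
      ultimately show ?case unfolding f_var by simp
    qed
  qed

  have lind_lim: "(\<lambda>l. real (k l) * average (E l) (\<lambda>e. if \<bar>f l e\<bar> > \<eta> then (f l e)\<^sup>2 else 0)) \<longlonglongrightarrow> 0"
    if \<eta>: "0 < \<eta>" for \<eta>
  proof (rule tendsto_sandwich[OF _ _ tendsto_const])
    let ?L = "\<lambda>l. 1 / (s l)\<^sup>2 * (\<Sum>i=1..k l. Defs.lindeberg (\<P> l) (birkhoff T (a l i) (n l) (h l)) (\<eta> / 2 * s l))"
    show "\<forall>\<^sub>F l in sequentially. 0 \<le> real (k l) * average (E l) (\<lambda>e. if \<bar>f l e\<bar> > \<eta> then (f l e)\<^sup>2 else 0)"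
      by (intro always_eventually allI mult_nonneg_nonneg average_nonneg) auto
    show "\<forall>\<^sub>F l in sequentially. real (k l) * average (E l) (\<lambda>e. if \<bar>f l e\<bar> > \<eta> then (f l e)\<^sup>2 else 0)
        \<le> 4 * ?L l + 4 * \<delta> 2 l"
    proof (intro always_eventually allI)
      fix l
      have "0 < \<eta> * s l" using \<eta> s_pos[of l] by simp
      from divide_right_mono[OF IS.lindeberg_comparison[OF this, of l "h l"], of "(s l)\<^sup>2"]
      show "real (k l) * average (E l) (\<lambda>e. if \<bar>f l e\<bar> > \<eta> then (f l e)\<^sup>2 else 0) \<le> 4 * ?L l + 4 * \<delta> 2 l"
        unfolding f_lind by (simp add: g_def \<delta>_def a add_divide_distrib)
    qed
    have "(\<lambda>l. 4 * ?L l + 4 * \<delta> 2 l) \<longlonglongrightarrow> 4 * 0 + 4 * 0"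
      using \<eta> by (intro tendsto_intros lindeberg \<delta>_lim) auto
    then show "(\<lambda>l. 4 * ?L l + 4 * \<delta> 2 l) \<longlonglongrightarrow> 0" by simp
  qed

  define W where "W l q = (birkhoff T 0 (k l * (n l + M l)) (h l) q
      - (\<integral>x. birkhoff T 0 (k l * (n l + M l)) (h l) x \<partial>\<nu> l)) / s l" for l q
  have W_meas: "W l \<in> borel_measurable (\<nu> l)" for l
    by (simp add: measurable_def nu IS.sets_\<nu> IS.space_\<nu>)
  have "weak_conv_m (\<lambda>l. distr (\<nu> l) borel (W l)) std_normal_distribution"
  proof (rule levy_continuity)
    show "real_distribution (distr (\<nu> l) borel (W l))" for l
      using prob_space.real_distribution_distr[OF _ W_meas, of l] IS.prob_space_\<nu>[of l]
      by (simp add: nu)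
    show "real_distribution std_normal_distribution" by (rule real_dist_normal_dist)
    fix u :: real
    have lim0: "(\<lambda>l. 2 * \<bar>u\<bar> * (\<gamma> l + 2 * \<delta> 1 l)) \<longlonglongrightarrow> 2 * \<bar>u\<bar> * (0 + 2 * 0)"
      by (intro tendsto_intros \<gamma>_lim \<delta>_lim) simp
    have "(\<lambda>l. char (distr (\<nu> l) borel (W l)) u - average (E l) (\<lambda>e. iexp (u * f l e)) ^ k l) \<longlonglongrightarrow> 0"
    proof (rule Lim_null_comparison[OF always_eventually])
      show "\<forall>l. cmod (char (distr (\<nu> l) borel (W l)) u - average (E l) (\<lambda>e. iexp (u * f l e)) ^ k l)
          \<le> 2 * \<bar>u\<bar> * (\<gamma> l + 2 * \<delta> 1 l)"
      proof
        fix l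
        show "cmod (char (distr (\<nu> l) borel (W l)) u - average (E l) (\<lambda>e. iexp (u * f l e)) ^ k l)
            \<le> 2 * \<bar>u\<bar> * (\<gamma> l + 2 * \<delta> 1 l)"
          using IS.char_comparison[where l = l and h = "h l" and t = u, OF s_pos[of l]]
          by (simp add: W_def[abs_def] f_def g_def nu \<gamma>_def \<delta>_def)
      qed
      show "(\<lambda>l. 2 * \<bar>u\<bar> * (\<gamma> l + 2 * \<delta> 1 l)) \<longlonglongrightarrow> 0" using lim0 by simp
    qed
    from tendsto_add[OF this row_iid_lindeberg[where t = u, OF IS.finite_E IS.E_nonempty f_mean k_lim k_pos var_lim lind_lim]]
    show "(\<lambda>l. char (distr (\<nu> l) borel (W l)) u) \<longlonglongrightarrow> char std_normal_distribution u"
      by simp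
  qed
  then have "(\<lambda>l. cdf (distr (\<nu> l) borel (W l)) t) \<longlonglongrightarrow> cdf std_normal_distribution t"
    by (rule weak_conv_std_normal_cdf)
  moreover have "cdf (distr (\<nu> l) borel (W l)) t
      = measure (\<nu> l) {q \<in> space (\<nu> l). birkhoff T 0 (k l * (n l + M l)) (h l) q
          - (\<integral>x. birkhoff T 0 (k l * (n l + M l)) (h l) x \<partial>\<nu> l) \<le> t * s l}" for l
  proof -
    have "cdf (distr (\<nu> l) borel (W l)) t = measure (\<nu> l) (W l -` {..t} \<inter> space (\<nu> l))"
      unfolding cdf_def using W_meas by (intro measure_distr) auto
    also have "W l -` {..t} \<inter> space (\<nu> l)
        = {q \<in> space (\<nu> l). birkhoff T 0 (k l * (n l + M l)) (h l) q
          - (\<integral>x. birkhoff T 0 (k l * (n l + M l)) (h l) x \<partial>\<nu> l) \<le> t * s l}"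
      using s_pos[of l] by (auto simp: W_def pos_divide_le_eq)
    finally show ?thesis .
  qed
  ultimately show "(\<lambda>l. measure (\<nu> l)
            {q \<in> space (\<nu> l).
               birkhoff T 0 (k l * (n l + M l)) (h l) q
                 - (\<integral>x. birkhoff T 0 (k l * (n l + M l)) (h l) x \<partial>(\<nu> l)) \<le> t * s l})
          \<longlonglongrightarrow> cdf std_normal_distribution t"
    by simp
qed

end
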